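(* Let $R$ be a finite commutative ring with identity and $P$ a proper prime ideal of $R$ with $|P|\geq 2$; let $I=I(\Gamma_P(R))\subseteq S=k[x_1,\ldots,x_a,y_1,\ldots,y_b]$ be the edge ideal of the prime ideal graph, where $a=|P|-1$ and $b=|P|(|R/P|-1)$. For every integer $n\geq 1$, the number of minimal monomial generators of $I^n$ is $$\mu(I^n)=\sum_{s=0}^{n}\binom{s+b-1}{b-1}\left[\binom{2n-s+a-1}{a-1}-a\binom{n-s+a-2}{a-1}\right].$$ Equivalently, $$\mu(I^n)=\sum_{s=0}^{n}\binom{s+|P|(|R/P|-1)-1}{|P|(|R/P|-1)-1}\left[\binom{2n-s+|P|-2}{|P|-2}-(|P|-1)\binom{n-s+|P|-3}{|P|-2}\right].$$ Here the convention is that $\binom{u}{v}=0$ whenever $u<v$ or $v<0$.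
   Context: The prime ideal graph $\Gamma_P(R)$ is the simple graph with vertex set $R\setminus\{0\}$ in which two distinct vertices $x,y$ are adjacent if and only if $xy\in P$. Put $a=|P|-1$ and $b=|P|(|R/P|-1)=|R\setminus P|$. Write $P\setminus\{0\}=\{u_1,\ldots,u_a\}$, $R\setminus P=\{v_1,\ldots,v_b\}$; attach the variable $x_i$ to $u_i$ and $y_\ell$ to $v_\ell$. Let $k$ be a field and $S=k[x_1,\ldots,x_a,y_1,\ldots,y_b]$. The edge ideal $I=I(\Gamma_P(R))$ is the ideal of $S$ generated by the products of the two variables attached to the endpoints of each edge; explicitly $I=(x_ix_j,\;x_iy_\ell \mid 1\leq i<j\leq a,\;1\leq i\leq a,\;1\leq \ell\leq b)$. For a monomial ideal $L$, $\mu(L)$ denotes its number of minimal monomial generators. In the binomial convention, $u$ may be a negative integer (so e.g. $\binom{-1}{0}=0$). *)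

theory Defs
  imports
    "HOL-Algebra.Ideal_Product"
    "HOL-Algebra.QuotRing"
    "HOL-Library.Poly_Mapping"
begin

text \<open>
  A simple graph is a pair of a vertex set and a set of edges, each edge being a two-element
  set of vertices.
\<close>

definition prime_ideal_graph :: "('r, 'm) ring_scheme \<Rightarrow> 'r set \<Rightarrow> 'r set \<times> 'r set set" where
  "prime_ideal_graph R P =
     (carrier R - {\<zero>\<^bsub>R\<^esub>},
      {{x, y} |x y. x \<in> carrier R - {\<zero>\<^bsub>R\<^esub>} \<and> y \<in> carrier R - {\<zero>\<^bsub>R\<^esub>} \<and>
                    x \<noteq> y \<and> x \<otimes>\<^bsub>R\<^esub> y \<in> P})"

text \<open>
  The polynomial ring over the field \<open>'k\<close> whose variables are indexed by the elements of \<open>V\<close>.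
  An exponent vector is a finitely supported map from variables to naturals, and a polynomial is a
  finitely supported map from exponent vectors to coefficients. The ring operations are those of
  \<^theory>\<open>HOL-Library.Poly_Mapping\<close>; the carrier consists of the polynomials
  in which only variables from \<open>V\<close> occur.
\<close>

definition mpoly_ring :: "'v set \<Rightarrow> (('v \<Rightarrow>\<^sub>0 nat) \<Rightarrow>\<^sub>0 'k::field) ring" where
  "mpoly_ring V =
     \<lparr>carrier = {p. \<forall>m \<in> Poly_Mapping.keys p. Poly_Mapping.keys m \<subseteq> V},
      mult = (*), one = 1, zero = 0, add = (+)\<rparr>"

definition monom :: "('v \<Rightarrow>\<^sub>0 nat) \<Rightarrow> (('v \<Rightarrow>\<^sub>0 nat) \<Rightarrow>\<^sub>0 'k::field)" where
  "monom m = Poly_Mapping.single m 1"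

definition var :: "'v \<Rightarrow> (('v \<Rightarrow>\<^sub>0 nat) \<Rightarrow>\<^sub>0 'k::field)" where
  "var v = monom (Poly_Mapping.single v 1)"

definition monomials :: "'v set \<Rightarrow> (('v \<Rightarrow>\<^sub>0 nat) \<Rightarrow>\<^sub>0 'k::field) set" where
  "monomials V = {monom m |m. Poly_Mapping.keys m \<subseteq> V}"

lemma mpoly_ring_cring: "cring (mpoly_ring V :: (('v \<Rightarrow>\<^sub>0 nat) \<Rightarrow>\<^sub>0 'k::field) ring)"
proof (rule cringI)
  let ?S = "mpoly_ring V :: (('v \<Rightarrow>\<^sub>0 nat) \<Rightarrow>\<^sub>0 'k) ring"
  have car: "p \<in> carrier ?S \<longleftrightarrow> (\<forall>m \<in> Poly_Mapping.keys p. Poly_Mapping.keys m \<subseteq> V)" for p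
    by (simp add: mpoly_ring_def)
  have ops: "mult ?S = (*)" "add ?S = (+)" "one ?S = 1" "zero ?S = 0"
    by (simp_all add: mpoly_ring_def)
  have plus: "p + q \<in> carrier ?S" if "p \<in> carrier ?S" "q \<in> carrier ?S" for p q
    using that Poly_Mapping.keys_add[of p q] unfolding car by blast
  have times: "p * q \<in> carrier ?S" if p: "p \<in> carrier ?S" and q: "q \<in> carrier ?S" for p q
    unfolding car
  proof
    fix m assume m: "m \<in> Poly_Mapping.keys (p * q)"
    obtain a b where ab: "m = a + b" "a \<in> Poly_Mapping.keys p" "b \<in> Poly_Mapping.keys q"
      using m keys_mult[of p q] by blast
    have "Poly_Mapping.keys m \<subseteq> Poly_Mapping.keys a \<union> Poly_Mapping.keys b"
      unfolding ab(1) by (rule Poly_Mapping.keys_add)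
    then show "Poly_Mapping.keys m \<subseteq> V"
      using ab(2,3) p q unfolding car by blast
  qed
  have zero: "0 \<in> carrier ?S" and one: "1 \<in> carrier ?S"
    unfolding car by simp_all
  have minus: "- p \<in> carrier ?S" if "p \<in> carrier ?S" for p
    using that unfolding car keys_minus by simp
  show "abelian_group ?S"
  proof (rule abelian_groupI, unfold ops)
    show "\<exists>y \<in> carrier ?S. y + x = 0" if "x \<in> carrier ?S" for x
      using minus[OF that] by (intro bexI[of _ "- x"]) simp_all
  qed (rule plus zero add.assoc add.commute add_0_left; assumption)+
  show "Group.comm_monoid ?S"
    by (rule comm_monoidI, unfold ops) (rule times one mult.assoc mult.commute mult_1_left; assumption)+
  show "(x \<oplus>\<^bsub>?S\<^esub> y) \<otimes>\<^bsub>?S\<^esub> z = x \<otimes>\<^bsub>?S\<^esub> z \<oplus>\<^bsub>?S\<^esub> y \<otimes>\<^bsub>?S\<^esub> z" for x y z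
    unfolding ops by (rule distrib_right)
qed

definition edge_ideal :: "'v set \<times> 'v set set \<Rightarrow> (('v \<Rightarrow>\<^sub>0 nat) \<Rightarrow>\<^sub>0 'k::field) set" where
  "edge_ideal \<Gamma> = Idl\<^bsub>mpoly_ring (fst \<Gamma>)\<^esub> {var x * var y |x y. {x, y} \<in> snd \<Gamma>}"

text \<open>
  A minimal monomial generating set is an irredundant set of monomials generating the ideal. When
  \<open>V\<close> is finite, every monomial ideal has exactly one, and \<open>\<mu>\<close> counts its elements.
\<close>

definition minimal_monomial_generators ::
    "'v set \<Rightarrow> (('v \<Rightarrow>\<^sub>0 nat) \<Rightarrow>\<^sub>0 'k::field) set \<Rightarrow> (('v \<Rightarrow>\<^sub>0 nat) \<Rightarrow>\<^sub>0 'k) set \<Rightarrow> bool" where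
  "minimal_monomial_generators V L G \<longleftrightarrow>
     G \<subseteq> monomials V \<and> Idl\<^bsub>mpoly_ring V\<^esub> G = L \<and> (\<forall>H. H \<subset> G \<longrightarrow> Idl\<^bsub>mpoly_ring V\<^esub> H \<noteq> L)"

definition mu :: "'v set \<Rightarrow> (('v \<Rightarrow>\<^sub>0 nat) \<Rightarrow>\<^sub>0 'k::field) set \<Rightarrow> nat" where
  "mu V L = card (THE G. minimal_monomial_generators V L G)"

text \<open>
  Binomial coefficient of integers, zero outside the range \<open>0 \<le> v \<le> u\<close>. In particular
  \<open>binom (- 1) 0 = 0\<close>, unlike for the library's generalised binomial coefficient.
\<close>

definition binom :: "int \<Rightarrow> int \<Rightarrow> int" where
  "binom u v = (if u < v \<or> v < 0 then 0 else int (nat u choose nat v))"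

end

theory Submission
  imports Defs "HOL-Library.Multiset"
begin

text \<open>
  Let \<open>U = P - {0}\<close> and \<open>W = R - P\<close>. Since \<open>P\<close> is prime, \<open>xy \<in> P\<close> means that \<open>x\<close> or \<open>y\<close> lies in
  \<open>P\<close>; so the prime ideal graph is the complete multipartite graph whose parts are the singletons
  of \<open>U\<close> together with the one part \<open>W\<close>.

  All generators of a power of an edge ideal have the same degree, so none divides another, and the
  number of minimal generators of \<open>I\<^sup>n\<close> is simply the number of exponent vectors that are sums of
  \<open>n\<close> edges (\<open>monomial_span_power\<close>, \<open>mu_monomial_span\<close>).

  For a complete multipartite graph these vectors can be recognised without mentioning edges
  (\<open>iterated_sumset_multipartite_edges\<close>): the total degree is \<open>2n\<close> and no part carries degree more
  than \<open>n\<close>. The bound is necessary because an edge meets a part at most once. It is sufficient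
  because an edge between the two heaviest parts can be removed without violating the bound for
  \<open>n - 1\<close>.

  It remains to count. Fixing the degree \<open>s \<le> n\<close> on \<open>W\<close> leaves a free choice of a vector of degree
  \<open>s\<close> on \<open>W\<close>, and a choice of a vector of degree \<open>2n - s\<close> on \<open>U\<close> with all entries at most \<open>n\<close>. Stars
  and bars counts both kinds, with the bound on the entries removed; and since two entries above
  \<open>n\<close> would already exceed the degree \<open>2n - s\<close>, inclusion-exclusion for the bound stops
  after its first correction term (\<open>int_card_exponents_bounded\<close>).
\<close>

section \<open>Monomial ideals\<close>

text \<open>
  The monomial ideal generated by \<open>M\<close>, encoded as a divisibility condition on supports instead of
  an intersection of ideals, so that membership of a monomial can be read off the exponents;
  \<open>Idl_monom_image\<close> identifies it with the generated ideal.
\<close>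

definition monomial_span ::
    "'v set \<Rightarrow> ('v \<Rightarrow>\<^sub>0 nat) set \<Rightarrow> (('v \<Rightarrow>\<^sub>0 nat) \<Rightarrow>\<^sub>0 'k::field) set" where
  "monomial_span V M =
     {p \<in> carrier (mpoly_ring V). \<forall>m \<in> Poly_Mapping.keys p. \<exists>d \<in> M. \<exists>e. m = d + e}"

lemma keys_add_nat:
  "Poly_Mapping.keys (d + e) = Poly_Mapping.keys d \<union> Poly_Mapping.keys (e :: 'v \<Rightarrow>\<^sub>0 nat)"
  by (auto simp: in_keys_iff lookup_add)

lemma carrier_mpoly_ring:
  "p \<in> carrier (mpoly_ring V) \<longleftrightarrow> (\<forall>m \<in> Poly_Mapping.keys p. Poly_Mapping.keys m \<subseteq> V)"
  by (simp add: mpoly_ring_def)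

lemma mpoly_ring_simps:
  "(\<otimes>\<^bsub>mpoly_ring V\<^esub>) = (*)" "add (mpoly_ring V) = (+)"
  "one (mpoly_ring V) = 1" "zero (mpoly_ring V) = 0"
  by (simp_all add: mpoly_ring_def)

lemma monom_mult: "monom (d + e) = monom d * (monom e :: ('v \<Rightarrow>\<^sub>0 nat) \<Rightarrow>\<^sub>0 'k::field)"
  by (simp add: monom_def mult_single)

lemma inj_monom: "inj (monom :: ('v \<Rightarrow>\<^sub>0 nat) \<Rightarrow> (('v \<Rightarrow>\<^sub>0 nat) \<Rightarrow>\<^sub>0 'k::field))"
proof (rule injI)
  fix m n :: "'v \<Rightarrow>\<^sub>0 nat"
  assume "monom m = (monom n :: ('v \<Rightarrow>\<^sub>0 nat) \<Rightarrow>\<^sub>0 'k)"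
  then have "Poly_Mapping.keys (monom m :: ('v \<Rightarrow>\<^sub>0 nat) \<Rightarrow>\<^sub>0 'k) = Poly_Mapping.keys (monom n :: ('v \<Rightarrow>\<^sub>0 nat) \<Rightarrow>\<^sub>0 'k)"
    by simp
  then show "m = n"
    by (simp add: monom_def)
qed

lemma monom_in_monomial_span_iff:
  "(monom m :: ('v \<Rightarrow>\<^sub>0 nat) \<Rightarrow>\<^sub>0 'k::field) \<in> monomial_span V M \<longleftrightarrow>
     Poly_Mapping.keys m \<subseteq> V \<and> (\<exists>d \<in> M. \<exists>e. m = d + e)"
  by (simp add: monomial_span_def carrier_mpoly_ring monom_def)

lemma monom_in_monomial_span:
  assumes "m \<in> M" and "Poly_Mapping.keys m \<subseteq> V"
  shows "(monom m :: ('v \<Rightarrow>\<^sub>0 nat) \<Rightarrow>\<^sub>0 'k::field) \<in> monomial_span V M"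
  unfolding monom_in_monomial_span_iff using assms add_0_right[of m] by metis

lemma ideal_monomial_span:
  "ideal (monomial_span V M :: (('v \<Rightarrow>\<^sub>0 nat) \<Rightarrow>\<^sub>0 'k::field) set) (mpoly_ring V)"
proof -
  let ?S = "mpoly_ring V :: (('v \<Rightarrow>\<^sub>0 nat) \<Rightarrow>\<^sub>0 'k) ring"
  let ?J = "monomial_span V M :: (('v \<Rightarrow>\<^sub>0 nat) \<Rightarrow>\<^sub>0 'k) set"
  interpret cring ?S by (rule mpoly_ring_cring)
  have sub: "?J \<subseteq> carrier ?S"
    by (auto simp: monomial_span_def)
  have times: "p * q \<in> ?J" if p: "p \<in> ?J" and q: "q \<in> carrier ?S" for p q
  proof -
    have "\<exists>d \<in> M. \<exists>e. m = d + e" if m: "m \<in> Poly_Mapping.keys (p * q)" for m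
    proof -
      obtain x y where "m = x + y" "x \<in> Poly_Mapping.keys p"
        using m keys_mult[of p q] by blast
      moreover obtain d e where "d \<in> M" "x = d + e"
        using p \<open>x \<in> Poly_Mapping.keys p\<close> unfolding monomial_span_def by blast
      ultimately show ?thesis
        by (metis add.assoc)
    qed
    moreover have "p * q \<in> carrier ?S"
      using m_closed[of p q] p q sub by (auto simp: mpoly_ring_simps)
    ultimately show ?thesis
      by (simp add: monomial_span_def)
  qed
  have neg: "\<ominus>\<^bsub>?S\<^esub> p = - p" if "p \<in> carrier ?S" for p
    using that by (intro minus_equality) (simp_all add: mpoly_ring_simps carrier_mpoly_ring)
  show ?thesis
  proof (rule idealI)
    show "subgroup ?J (add_monoid ?S)"
    proof (rule add.subgroupI)
      show "?J \<noteq> {}"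
        by (auto simp: monomial_span_def carrier_mpoly_ring intro!: exI[of _ 0])
      show "\<ominus>\<^bsub>?S\<^esub> p \<in> ?J" if "p \<in> ?J" for p
        using that sub neg[of p] by (auto simp: monomial_span_def carrier_mpoly_ring)
      show "p \<oplus>\<^bsub>?S\<^esub> q \<in> ?J" if "p \<in> ?J" "q \<in> ?J" for p q
        using that Poly_Mapping.keys_add[of p q]
        unfolding mpoly_ring_simps monomial_span_def carrier_mpoly_ring by blast
    qed (rule sub)
    show "x \<otimes>\<^bsub>?S\<^esub> p \<in> ?J" "p \<otimes>\<^bsub>?S\<^esub> x \<in> ?J" if "p \<in> ?J" "x \<in> carrier ?S" for p x
      using times[OF that] by (simp_all add: mpoly_ring_simps mult.commute)
  qed (rule ring_axioms)
qed

text \<open>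
  Each term \<open>c x\<^sup>m\<close> of an element of the span is a multiple of a generator, and the element is the
  sum of its terms.
\<close>

lemma monomial_span_minimal:
  fixes J :: "(('v \<Rightarrow>\<^sub>0 nat) \<Rightarrow>\<^sub>0 'k::field) set"
  assumes J: "ideal J (mpoly_ring V)" and M: "monom ` M \<subseteq> J"
  shows "monomial_span V M \<subseteq> J"
proof
  let ?S = "mpoly_ring V :: (('v \<Rightarrow>\<^sub>0 nat) \<Rightarrow>\<^sub>0 'k) ring"
  interpret ideal J ?S by (rule J)
  fix p :: "('v \<Rightarrow>\<^sub>0 nat) \<Rightarrow>\<^sub>0 'k"
  assume p: "p \<in> monomial_span V M"
  have single: "Poly_Mapping.single m c \<in> J" if m: "m \<in> Poly_Mapping.keys p" for m c
  proof -
    obtain d e where d: "d \<in> M" and m_eq: "m = d + e"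
      using p m unfolding monomial_span_def by blast
    have "Poly_Mapping.keys e \<subseteq> Poly_Mapping.keys m"
      by (simp add: m_eq keys_add_nat)
    also have "\<dots> \<subseteq> V"
      using p m by (simp add: monomial_span_def carrier_mpoly_ring)
    finally have "Poly_Mapping.single e c \<in> carrier ?S"
      by (simp add: carrier_mpoly_ring)
    then have "Poly_Mapping.single e c * monom d \<in> J"
      using I_l_closed[of "monom d"] M d by (auto simp: mpoly_ring_simps)
    then show ?thesis
      by (simp add: m_eq monom_def mult_single add.commute)
  qed
  have "(\<Sum>m\<in>A. Poly_Mapping.single m (Poly_Mapping.lookup p m)) \<in> J"
    if "A \<subseteq> Poly_Mapping.keys p" for A
    using finite_subset[OF that finite_keys] that
  proof (induction A rule: finite_induct)
    case empty
    then show ?case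
      using additive_subgroup.zero_closed[OF additive_subgroup_axioms]
      by (simp add: mpoly_ring_simps)
  next
    case (insert m A)
    then show ?case
      using additive_subgroup.a_closed[OF additive_subgroup_axioms single]
      by (simp add: mpoly_ring_simps)
  qed
  moreover have "(\<Sum>m\<in>Poly_Mapping.keys p. Poly_Mapping.single m (Poly_Mapping.lookup p m)) = p"
    by (rule poly_mapping_eqI)
      (simp add: lookup_sum lookup_single when_def sum.delta[OF finite_keys] in_keys_iff)
  ultimately show "p \<in> J"
    by (metis order_refl)
qed

lemma Idl_monom_image:
  assumes "\<And>m. m \<in> M \<Longrightarrow> Poly_Mapping.keys m \<subseteq> V"
  shows "Idl\<^bsub>mpoly_ring V\<^esub> (monom ` M) =
           (monomial_span V M :: (('v \<Rightarrow>\<^sub>0 nat) \<Rightarrow>\<^sub>0 'k::field) set)"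
proof
  let ?S = "mpoly_ring V :: (('v \<Rightarrow>\<^sub>0 nat) \<Rightarrow>\<^sub>0 'k) ring"
  interpret cring ?S by (rule mpoly_ring_cring)
  have M: "monom ` M \<subseteq> (monomial_span V M :: (('v \<Rightarrow>\<^sub>0 nat) \<Rightarrow>\<^sub>0 'k) set)"
    using assms by (auto intro: monom_in_monomial_span)
  then show "Idl\<^bsub>?S\<^esub> (monom ` M) \<subseteq> monomial_span V M"
    by (rule genideal_minimal[OF ideal_monomial_span])
  have carr: "monom ` M \<subseteq> carrier ?S"
    using M by (auto simp: monomial_span_def)
  show "monomial_span V M \<subseteq> Idl\<^bsub>?S\<^esub> (monom ` M)"
    by (rule monomial_span_minimal[OF genideal_ideal[OF carr] genideal_self[OF carr]])
qed

lemma ideal_prod_monomial_span: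
  assumes M: "\<And>m. m \<in> M \<Longrightarrow> Poly_Mapping.keys m \<subseteq> V"
    and N: "\<And>m. m \<in> N \<Longrightarrow> Poly_Mapping.keys m \<subseteq> V"
  shows "monomial_span V M \<cdot>\<^bsub>mpoly_ring V\<^esub> monomial_span V N =
           (monomial_span V {d + e |d e. d \<in> M \<and> e \<in> N} :: (('v \<Rightarrow>\<^sub>0 nat) \<Rightarrow>\<^sub>0 'k::field) set)"
    (is "?A \<cdot>\<^bsub>?S\<^esub> ?B = ?C")
proof
  interpret cring ?S by (rule mpoly_ring_cring)
  show "?A \<cdot>\<^bsub>?S\<^esub> ?B \<subseteq> ?C"
  proof
    fix p assume "p \<in> ?A \<cdot>\<^bsub>?S\<^esub> ?B"
    then show "p \<in> ?C"
    proof (induction p rule: ideal_prod.induct)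
      case (prod p q)
      then have "p \<otimes>\<^bsub>?S\<^esub> q \<in> carrier ?S"
        by (intro m_closed) (auto simp: monomial_span_def)
      moreover have "\<exists>d \<in> {d + e |d e. d \<in> M \<and> e \<in> N}. \<exists>e. m = d + e"
        if m: "m \<in> Poly_Mapping.keys (p * q)" for m
      proof -
        obtain x y where xy: "m = x + y" "x \<in> Poly_Mapping.keys p" "y \<in> Poly_Mapping.keys q"
          using m keys_mult[of p q] by blast
        obtain d d' where d: "d \<in> M" "x = d + d'"
          using prod xy unfolding monomial_span_def by blast
        obtain e e' where e: "e \<in> N" "y = e + e'"
          using prod xy unfolding monomial_span_def by blast
        have "m = (d + e) + (d' + e')"
          using xy d e by (simp add: ac_simps)
        then show ?thesis
          using d e by blast
      qed
      ultimately show ?case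
        unfolding monomial_span_def[of V "{d + e |d e. d \<in> M \<and> e \<in> N}"] by (simp add: mpoly_ring_simps)
    next
      case (sum p q)
      then show ?case
        using additive_subgroup.a_closed[OF ideal.axioms(1)[OF ideal_monomial_span]] by blast
    qed
  qed
  have "monom ` {d + e |d e. d \<in> M \<and> e \<in> N} \<subseteq> ?A \<cdot>\<^bsub>?S\<^esub> ?B"
  proof clarify
    fix d e assume "d \<in> M" "e \<in> N"
    then have "monom d \<in> ?A" "monom e \<in> ?B"
      using M N by (auto intro: monom_in_monomial_span)
    then show "monom (d + e) \<in> ?A \<cdot>\<^bsub>?S\<^esub> ?B"
      unfolding monom_mult using ideal_prod.prod[of "monom d" ?A "monom e" ?B ?S]
      by (simp add: mpoly_ring_simps)
  qed
  then show "?C \<subseteq> ?A \<cdot>\<^bsub>?S\<^esub> ?B"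
    by (rule monomial_span_minimal[OF ideal_prod_is_ideal[OF ideal_monomial_span ideal_monomial_span]])
qed

section \<open>Powers and minimal generators\<close>

primrec iterated_sumset :: "'a::comm_monoid_add set \<Rightarrow> nat \<Rightarrow> 'a set" where
  "iterated_sumset E 0 = {0}"
| "iterated_sumset E (Suc n) = {d + e |d e. d \<in> iterated_sumset E n \<and> e \<in> E}"

lemma keys_iterated_sumset:
  fixes E :: "('v \<Rightarrow>\<^sub>0 nat) set"
  assumes E: "\<And>m. m \<in> E \<Longrightarrow> Poly_Mapping.keys m \<subseteq> V"
  shows "m \<in> iterated_sumset E n \<Longrightarrow> Poly_Mapping.keys m \<subseteq> V"
proof (induction n arbitrary: m)
  case (Suc n)
  then obtain d e where "m = d + e" "d \<in> iterated_sumset E n" "e \<in> E"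
    by auto
  then show ?case
    using Suc.IH E by (simp add: keys_add_nat)
qed simp

lemma monomial_span_power:
  assumes E: "\<And>m. m \<in> E \<Longrightarrow> Poly_Mapping.keys m \<subseteq> V"
  shows "monomial_span V E [^]\<^bsub>ideals_set (mpoly_ring V)\<^esub> (n::nat) =
           (monomial_span V (iterated_sumset E n) :: (('v \<Rightarrow>\<^sub>0 nat) \<Rightarrow>\<^sub>0 'k::field) set)"
proof -
  let ?S = "mpoly_ring V :: (('v \<Rightarrow>\<^sub>0 nat) \<Rightarrow>\<^sub>0 'k) ring"
  interpret S: cring ?S by (rule mpoly_ring_cring)
  interpret T: semiring "ideals_set ?S" by (rule S.ideals_set_is_semiring)
  show ?thesis
  proof (induction n)
    case 0
    then show ?case
      by (auto simp: monomial_span_def ideals_set_def)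
  next
    case (Suc n)
    then show ?case
      using ideal_prod_monomial_span[OF keys_iterated_sumset[OF E] E]
      by (simp add: ideals_set_def)
  qed
qed

text \<open>
  If \<open>N\<close> generates the same ideal as the antichain \<open>M\<close>, then each \<open>m \<in> M\<close> is divisible by some
  \<open>d \<in> N\<close>, which is in turn divisible by some \<open>c \<in> M\<close>. The antichain condition turns both
  divisibilities into equalities, so \<open>M \<subseteq> N\<close>. Hence \<open>M\<close> is the least monomial generating set and
  therefore the only irredundant one.
\<close>

lemma mu_monomial_span:
  assumes M: "\<And>m. m \<in> M \<Longrightarrow> Poly_Mapping.keys m \<subseteq> V"
    and antichain: "\<And>m d e. m \<in> M \<Longrightarrow> d \<in> M \<Longrightarrow> m = d + e \<Longrightarrow> e = 0"
  shows "mu V (monomial_span V M :: (('v \<Rightarrow>\<^sub>0 nat) \<Rightarrow>\<^sub>0 'k::field) set) = card M"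
proof -
  let ?S = "mpoly_ring V :: (('v \<Rightarrow>\<^sub>0 nat) \<Rightarrow>\<^sub>0 'k) ring"
  let ?L = "monomial_span V M :: (('v \<Rightarrow>\<^sub>0 nat) \<Rightarrow>\<^sub>0 'k) set"
  have generators: "Idl\<^bsub>?S\<^esub> (monom ` M) = ?L"
    by (rule Idl_monom_image) (rule M)
  have generating_contains: "M \<subseteq> N"
    if N: "\<And>m. m \<in> N \<Longrightarrow> Poly_Mapping.keys m \<subseteq> V" and gen: "Idl\<^bsub>?S\<^esub> (monom ` N) = ?L" for N
  proof
    fix m assume m: "m \<in> M"
    have span: "monomial_span V N = ?L"
      unfolding gen[symmetric] by (rule Idl_monom_image[symmetric]) (rule N)
    have "monom m \<in> ?L"
      using M m by (auto intro: monom_in_monomial_span)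
    then obtain d e where d: "d \<in> N" "m = d + e"
      by (auto simp: monom_in_monomial_span_iff simp flip: span)
    have "monom d \<in> (monomial_span V N :: (('v \<Rightarrow>\<^sub>0 nat) \<Rightarrow>\<^sub>0 'k) set)"
      using N d by (auto intro: monom_in_monomial_span)
    then obtain c f where c: "c \<in> M" "d = c + f"
      by (auto simp: monom_in_monomial_span_iff span)
    have "f + e = 0"
      using antichain[OF m c(1)] d c by (simp add: add.assoc)
    then have "e = 0"
      by (metis keys_add_nat keys_eq_empty sup_eq_bot_iff)
    then show "m \<in> N"
      using d by simp
  qed
  have subset_monomials: "\<exists>N. G = monom ` N \<and> (\<forall>m\<in>N. Poly_Mapping.keys m \<subseteq> V)"
    if "G \<subseteq> monomials V" for G :: "(('v \<Rightarrow>\<^sub>0 nat) \<Rightarrow>\<^sub>0 'k) set"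
    using that unfolding monomials_def
    by (intro exI[of _ "{m. monom m \<in> G}"]) (auto dest: injD[OF inj_monom])
  have "(THE G. minimal_monomial_generators V ?L G) = monom ` M"
  proof (rule the_equality)
    have irredundant: "Idl\<^bsub>?S\<^esub> H \<noteq> ?L" if H: "H \<subset> monom ` M" for H
    proof
      assume gen: "Idl\<^bsub>?S\<^esub> H = ?L"
      obtain N where N: "N \<subseteq> M" "H = monom ` N"
        using H by (meson psubset_imp_subset subset_imageE)
      have "M \<subseteq> N"
        using generating_contains[of N] M N gen by blast
      then show False
        using H N by blast
    qed
    have "monom ` M \<subseteq> (monomials V :: (('v \<Rightarrow>\<^sub>0 nat) \<Rightarrow>\<^sub>0 'k) set)"
      unfolding monomials_def using M by blast
    then show "minimal_monomial_generators V ?L (monom ` M)"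
      unfolding minimal_monomial_generators_def
      by (intro conjI allI impI generators irredundant)
  next
    fix G assume G: "minimal_monomial_generators V ?L G"
    then have G_monomials: "G \<subseteq> monomials V" and G_gen: "Idl\<^bsub>?S\<^esub> G = ?L"
      and G_min: "\<And>H. H \<subset> G \<Longrightarrow> Idl\<^bsub>?S\<^esub> H \<noteq> ?L"
      unfolding minimal_monomial_generators_def by simp_all
    obtain N where N: "G = monom ` N" "\<forall>m\<in>N. Poly_Mapping.keys m \<subseteq> V"
      using subset_monomials[OF G_monomials] by metis
    have "M \<subseteq> N"
      by (rule generating_contains) (use N G_gen in simp_all)
    then have "monom ` M \<subseteq> G"
      unfolding N(1) by (rule image_mono)
    moreover have "\<not> monom ` M \<subset> G"
      using G_min generators by metis
    ultimately show "G = monom ` M"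
      by blast
  qed
  then show ?thesis
    unfolding mu_def by (simp add: card_image inj_on_subset[OF inj_monom])
qed

section \<open>Edge powers of complete multipartite graphs\<close>

text \<open>
  The exponent vectors of the edges of the complete multipartite graph on \<open>V\<close> whose parts are the
  fibres of \<open>part\<close>.
\<close>

definition multipartite_edges :: "('v \<Rightarrow> 'c) \<Rightarrow> 'v set \<Rightarrow> ('v \<Rightarrow>\<^sub>0 nat) set" where
  "multipartite_edges part V =
     {Poly_Mapping.single x 1 + Poly_Mapping.single y 1 |x y. x \<in> V \<and> y \<in> V \<and> part x \<noteq> part y}"

definition exponents_of_degree :: "'v set \<Rightarrow> nat \<Rightarrow> ('v \<Rightarrow>\<^sub>0 nat) set" where
  "exponents_of_degree A d =
     {m. Poly_Mapping.keys m \<subseteq> A \<and> sum (Poly_Mapping.lookup m) A = d}"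

definition part_degree :: "('v \<Rightarrow> 'c) \<Rightarrow> 'v set \<Rightarrow> ('v \<Rightarrow>\<^sub>0 nat) \<Rightarrow> 'c \<Rightarrow> nat" where
  "part_degree part V m c = sum (Poly_Mapping.lookup m) {v \<in> V. part v = c}"

lemma part_degree_add:
  "part_degree part V (d + e) c = part_degree part V d c + part_degree part V e c"
  by (simp add: part_degree_def lookup_add sum.distrib)

lemma sum_lookup_single:
  assumes "finite A"
  shows "sum (Poly_Mapping.lookup (Poly_Mapping.single x k)) A = (if x \<in> A then k else 0)"
  using assms by (simp add: lookup_single when_def)

lemma part_degree_single:
  assumes "finite V" "x \<in> V"
  shows "part_degree part V (Poly_Mapping.single x k) c = (if part x = c then k else 0)"
  using assms by (simp add: part_degree_def sum_lookup_single)

lemma sum_part_degree: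
  assumes "finite V"
  shows "(\<Sum>c\<in>part ` V. part_degree part V m c) = sum (Poly_Mapping.lookup m) V"
  unfolding part_degree_def by (rule sum.image_gen[OF assms, of "Poly_Mapping.lookup m" part, symmetric])

lemma part_degree_pos:
  assumes "part_degree part V m c > 0"
  obtains x where "x \<in> V" "part x = c" "Poly_Mapping.lookup m x > 0"
proof -
  have "\<exists>x \<in> {v \<in> V. part v = c}. Poly_Mapping.lookup m x \<noteq> 0"
  proof (rule ccontr)
    assume "\<not> ?thesis"
    then have "part_degree part V m c = 0"
      unfolding part_degree_def by (intro sum.neutral) blast
    then show False
      using assms by simp
  qed
  then show ?thesis
    using that by auto
qed

text \<open>
  A largest and a second largest value do the job: a third index \<open>c\<close> with \<open>f c \<ge> N\<close> would force
  three values of at least \<open>N\<close> each, against the total \<open>2 * N\<close>. The second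
  value is positive because the first one accounts for at most half of the total.
\<close>

lemma two_largest_parts:
  fixes f :: "'c \<Rightarrow> nat"
  assumes C: "finite C" and total: "sum f C = 2 * N" and bound: "\<And>c. c \<in> C \<Longrightarrow> f c \<le> N" and "N > 0"
  obtains p q where "p \<in> C" "q \<in> C" "p \<noteq> q" "f p > 0" "f q > 0"
    "\<And>c. c \<in> C \<Longrightarrow> c \<noteq> p \<Longrightarrow> c \<noteq> q \<Longrightarrow> f c < N"
proof -
  have "C \<noteq> {}"
    using total \<open>N > 0\<close> by auto
  then obtain p where p: "p \<in> C" and p_max: "\<And>c. c \<in> C \<Longrightarrow> f c \<le> f p"
    using C obtains_MAX[of C f] by (metis (mono_tags, lifting) Max_ge finite_imageI imageI)
  have rest: "f p + sum f (C - {p}) = 2 * N"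
    using C p total by (simp add: sum.remove)
  then have rest_pos: "sum f (C - {p}) \<ge> N"
    using bound[OF p] by linarith
  then have "C - {p} \<noteq> {}"
    using \<open>N > 0\<close> by (metis sum.empty not_le)
  then obtain q where q: "q \<in> C - {p}" and q_max: "\<And>c. c \<in> C - {p} \<Longrightarrow> f c \<le> f q"
    using C obtains_MAX[of "C - {p}" f] by (metis (mono_tags, lifting) Max_ge finite_Diff finite_imageI imageI)
  have "f q > 0"
  proof (rule ccontr)
    assume "\<not> f q > 0"
    then have "sum f (C - {p}) = 0"
      using q_max by (intro sum.neutral) fastforce
    then show False
      using rest_pos \<open>N > 0\<close> by simp
  qed
  moreover have "f c < N" if c: "c \<in> C" "c \<noteq> p" "c \<noteq> q" for c
  proof (rule ccontr)
    assume "\<not> f c < N"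
    have "f p + f q + f c = sum f {p, q, c}"
      using c q by auto
    also have "\<dots> \<le> sum f C"
      using C p q c by (intro sum_mono2) auto
    finally have "f p + f q + f c \<le> 2 * N"
      using total by simp
    moreover have "f c \<le> f q" "f c \<le> f p"
      using p_max q_max c by auto
    ultimately show False
      using \<open>\<not> f c < N\<close> \<open>N > 0\<close> by linarith
  qed
  moreover have "f p > 0"
    using \<open>f q > 0\<close> p_max[of q] q by auto
  ultimately show thesis
    using that[of p q] p q by auto
qed

lemma exponents_of_degree_0:
  assumes "finite A"
  shows "exponents_of_degree A 0 = {0}"
proof -
  have "m = 0" if "Poly_Mapping.keys m \<subseteq> A" "sum (Poly_Mapping.lookup m) A = 0"
    for m :: "'a \<Rightarrow>\<^sub>0 nat"
  proof (rule poly_mapping_eqI)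
    show "Poly_Mapping.lookup m v = Poly_Mapping.lookup 0 v" for v
      using that assms by (cases "v \<in> A") (auto simp: in_keys_iff subset_iff)
  qed
  then show ?thesis
    by (auto simp: exponents_of_degree_def)
qed

text \<open>
  A vector of degree \<open>2 * n\<close> is a sum of \<open>n\<close> edges exactly when no part carries more than half of the
  degree. For the nontrivial direction, by induction on \<open>n\<close>, an edge is subtracted so that the
  bound drops from \<open>Suc n\<close> to \<open>n\<close>: it has to meet every part that attains the bound, which
  \<open>two_largest_parts\<close> makes possible.
\<close>

lemma iterated_sumset_multipartite_edges:
  assumes V: "finite V"
  shows "iterated_sumset (multipartite_edges part V) n =
           {m \<in> exponents_of_degree V (2 * n). \<forall>v \<in> V. part_degree part V m (part v) \<le> n}"
proof (induction n)
  case 0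
  have "part_degree part V 0 c = 0" for c
    by (simp add: part_degree_def)
  then have "{m \<in> {0}. \<forall>v \<in> V. part_degree part V m (part v) \<le> 0} = {0}"
    by auto
  then show ?case
    by (simp add: exponents_of_degree_0[OF V])
next
  case (Suc n)
  let ?E = "multipartite_edges part V"
  let ?D = "\<lambda>n. {m \<in> exponents_of_degree V (2 * n). \<forall>v \<in> V. part_degree part V m (part v) \<le> n}"
  have "m \<in> ?D (Suc n)" if m: "m \<in> iterated_sumset ?E (Suc n)" for m
  proof -
    obtain d x y where m_eq: "m = d + (Poly_Mapping.single x 1 + Poly_Mapping.single y 1)"
      and d: "d \<in> ?D n" and xy: "x \<in> V" "y \<in> V" "part x \<noteq> part y"
      using m Suc.IH by (auto simp: multipartite_edges_def)
    have "part_degree part V m (part v) \<le> Suc n" if "v \<in> V" for v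
      using d xy that V by (auto simp: m_eq part_degree_add part_degree_single)
    then show ?thesis
      using d xy V
      by (simp add: m_eq exponents_of_degree_def keys_add_nat lookup_add sum.distrib sum_lookup_single)
  qed
  moreover have "m \<in> iterated_sumset ?E (Suc n)" if m: "m \<in> ?D (Suc n)" for m
  proof -
    let ?f = "part_degree part V m"
    obtain p q where pq: "p \<in> part ` V" "q \<in> part ` V" "p \<noteq> q" "?f p > 0" "?f q > 0"
      and others: "\<And>c. c \<in> part ` V \<Longrightarrow> c \<noteq> p \<Longrightarrow> c \<noteq> q \<Longrightarrow> ?f c < Suc n"
    proof (rule two_largest_parts[of "part ` V" ?f "Suc n"])
      show "sum ?f (part ` V) = 2 * Suc n"
        unfolding sum_part_degree[OF V] using m by (simp add: exponents_of_degree_def)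
    qed (use V m in auto)
    obtain x where x: "x \<in> V" "part x = p" "Poly_Mapping.lookup m x > 0"
      using part_degree_pos[OF pq(4)] .
    obtain y where y: "y \<in> V" "part y = q" "Poly_Mapping.lookup m y > 0"
      using part_degree_pos[OF pq(5)] .
    let ?e = "Poly_Mapping.single x 1 + Poly_Mapping.single y (1::nat)"
    define d where "d = m - ?e"
    have m_eq: "m = d + ?e"
      using x y pq(3) unfolding d_def
      by (intro poly_mapping_eqI) (auto simp: lookup_add lookup_minus lookup_single when_def)
    have "part_degree part V d (part v) \<le> n" if v: "v \<in> V" for v
    proof -
      have "?f (part v) = part_degree part V d (part v) +
          (if p = part v then 1 else 0) + (if q = part v then 1 else 0)"
        using x y V by (simp add: m_eq part_degree_add part_degree_single)
      moreover have "?f (part v) \<le> Suc n"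
        using m v by simp
      \<comment> \<open>The parts \<open>p\<close> and \<open>q\<close> lose one unit each; all others were below \<open>Suc n\<close> already.\<close>
      ultimately show ?thesis
        using others[of "part v"] v pq(3) by (auto split: if_splits)
    qed
    moreover have "d \<in> exponents_of_degree V (2 * n)"
      using m x y V unfolding m_eq
      by (simp add: exponents_of_degree_def keys_add_nat lookup_add sum.distrib sum_lookup_single)
    ultimately have "d \<in> iterated_sumset ?E n"
      using Suc.IH by simp
    moreover have "?e \<in> ?E"
      using x y pq(3) unfolding multipartite_edges_def by blast
    ultimately show ?thesis
      using m_eq by auto
  qed
  ultimately show ?case
    by blast
qed

section \<open>Counting exponent vectors\<close>

text \<open>
  Exponent vectors are multisets in disguise; the transfer makes the stars-and-bars count for
  multisets available.
\<close>

lemma bij_betw_multisets_exponents: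
  assumes A: "finite A"
  shows "bij_betw (\<lambda>M. Abs_poly_mapping (count M)) (multisets_of_size A d) (exponents_of_degree A d)"
proof (rule bij_betw_byWitness[where f' = "\<lambda>m. Abs_multiset (Poly_Mapping.lookup m)"])
  have look: "Poly_Mapping.lookup (Abs_poly_mapping (count M)) = count M" for M :: "'a multiset"
    by (rule lookup_Abs_poly_mapping) simp
  have cnt: "count (Abs_multiset (Poly_Mapping.lookup m)) = Poly_Mapping.lookup m" for m :: "'a \<Rightarrow>\<^sub>0 nat"
    by (rule count_Abs_multiset) simp
  have size: "size M = sum (count M) A" if "set_mset M \<subseteq> A" for M :: "'a multiset"
    unfolding size_multiset_overloaded_eq using that A
    by (intro sum.mono_neutral_left) (auto simp: not_in_iff)
  show "\<forall>M\<in>multisets_of_size A d. Abs_multiset (Poly_Mapping.lookup (Abs_poly_mapping (count M))) = M"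
    by (simp add: look count_inverse)
  show "\<forall>m\<in>exponents_of_degree A d. Abs_poly_mapping (count (Abs_multiset (Poly_Mapping.lookup m))) = m"
    by (simp add: cnt lookup_inverse)
  have "Abs_poly_mapping (count M) \<in> exponents_of_degree A d" if "M \<in> multisets_of_size A d" for M
    using that size[of M]
    by (auto simp: multisets_of_size_def exponents_of_degree_def look in_keys_iff count_eq_zero_iff)
  then show "(\<lambda>M. Abs_poly_mapping (count M)) ` multisets_of_size A d \<subseteq> exponents_of_degree A d"
    by blast
  have "Abs_multiset (Poly_Mapping.lookup m) \<in> multisets_of_size A d" if "m \<in> exponents_of_degree A d" for m
  proof -
    have "set_mset (Abs_multiset (Poly_Mapping.lookup m)) \<subseteq> A"
      using that by (auto simp: set_mset_def cnt exponents_of_degree_def in_keys_iff)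
    then show ?thesis
      using that size[of "Abs_multiset (Poly_Mapping.lookup m)"]
      by (simp add: cnt multisets_of_size_def exponents_of_degree_def)
  qed
  then show "(\<lambda>m. Abs_multiset (Poly_Mapping.lookup m)) ` exponents_of_degree A d \<subseteq> multisets_of_size A d"
    by blast
qed

lemma finite_exponents_of_degree: "finite A \<Longrightarrow> finite (exponents_of_degree A d)"
  using bij_betw_finite[OF bij_betw_multisets_exponents] finite_multisets_of_size by metis

lemma card_exponents_of_degree:
  "finite A \<Longrightarrow> card (exponents_of_degree A d) = (card A + d - 1) choose d"
  using bij_betw_same_card[OF bij_betw_multisets_exponents] card_multisets_of_size by metis

lemma int_card_exponents_of_degree:
  assumes "finite A" "A \<noteq> {}"
  shows "int (card (exponents_of_degree A d)) =
           binom (int d + int (card A) - 1) (int (card A) - 1)"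
proof -
  obtain k where k: "card A = Suc k"
    using assms by (metis card_gt_0_iff gr0_implies_Suc)
  have "(d + k) choose d = (d + k) choose k"
    using binomial_symmetric[of k "d + k"] by simp
  then show ?thesis
    using card_exponents_of_degree[OF assms(1), of d] by (simp add: k binom_def add.commute nat_int_add)
qed

text \<open>
  Subtracting \<open>n + 1\<close> from the entry at \<open>u\<close> is a bijection onto all vectors of degree
  \<open>d - n - 1\<close>. For \<open>d \<le> n\<close> there are none, in agreement with the binomial coefficient, whose upper
  index is then smaller than the lower one.
\<close>

lemma card_exponents_exceeding:
  assumes A: "finite A" and u: "u \<in> A"
  shows "int (card {m \<in> exponents_of_degree A d. n < Poly_Mapping.lookup m u}) =
           binom (int d - int n - 1 + int (card A) - 1) (int (card A) - 1)"
proof (cases "n < d")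
  case True
  let ?s = "Poly_Mapping.single u (Suc n)"
  have "bij_betw (\<lambda>m. m + ?s) (exponents_of_degree A (d - Suc n))
          {m \<in> exponents_of_degree A d. n < Poly_Mapping.lookup m u}"
  proof (rule bij_betw_byWitness[where f' = "\<lambda>m. m - ?s"])
    have cancel: "m - ?s + ?s = m" if "n < Poly_Mapping.lookup m u" for m
      using that by (intro poly_mapping_eqI) (auto simp: lookup_add lookup_minus lookup_single when_def)
    then show "\<forall>m \<in> {m \<in> exponents_of_degree A d. n < Poly_Mapping.lookup m u}. m - ?s + ?s = m"
      by simp
    show "(\<lambda>m. m + ?s) ` exponents_of_degree A (d - Suc n)
            \<subseteq> {m \<in> exponents_of_degree A d. n < Poly_Mapping.lookup m u}"
      using True u A
      by (auto simp: exponents_of_degree_def keys_add_nat lookup_add sum.distrib sum_lookup_single)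
    have "m - ?s \<in> exponents_of_degree A (d - Suc n)"
      if "m \<in> exponents_of_degree A d" "n < Poly_Mapping.lookup m u" for m
    proof -
      define k where "k = m - ?s"
      have "k + ?s \<in> exponents_of_degree A d"
        unfolding k_def using cancel that by simp
      then have "k \<in> exponents_of_degree A (d - Suc n)"
        using u A
        by (auto simp: exponents_of_degree_def keys_add_nat lookup_add sum.distrib sum_lookup_single)
      then show ?thesis
        by (simp add: k_def)
    qed
    then show "(\<lambda>m. m - ?s) ` {m \<in> exponents_of_degree A d. n < Poly_Mapping.lookup m u}
            \<subseteq> exponents_of_degree A (d - Suc n)"
      by blast
  qed simp
  then have "card {m \<in> exponents_of_degree A d. n < Poly_Mapping.lookup m u} =
      card (exponents_of_degree A (d - Suc n))"
    by (rule bij_betw_same_card[symmetric])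
  then show ?thesis
    using int_card_exponents_of_degree[OF A, of "d - Suc n"] u True
    by (auto simp: of_nat_diff diff_diff_eq add.commute)
next
  case False
  have "Poly_Mapping.lookup m u \<le> d" if "m \<in> exponents_of_degree A d" for m
    using that member_le_sum[of u A "Poly_Mapping.lookup m"] u A by (simp add: exponents_of_degree_def)
  then have empty: "{m \<in> exponents_of_degree A d. n < Poly_Mapping.lookup m u} = {}"
    using False by fastforce
  show ?thesis
    unfolding empty using False by (simp add: binom_def)
qed

text \<open>
  The assumption on \<open>d\<close> rules out two entries above \<open>n\<close>, so the vectors exceeding the bound
  at the different places form disjoint sets.
\<close>

lemma int_card_exponents_bounded:
  assumes A: "finite A" "A \<noteq> {}" and d: "d \<le> 2 * n"
  shows "int (card {m \<in> exponents_of_degree A d. \<forall>u \<in> A. Poly_Mapping.lookup m u \<le> n}) =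
           binom (int d + int (card A) - 1) (int (card A) - 1)
           - int (card A) * binom (int d - int n - 1 + int (card A) - 1) (int (card A) - 1)"
proof -
  let ?X = "exponents_of_degree A d"
  let ?over = "\<lambda>u. {m \<in> ?X. n < Poly_Mapping.lookup m u}"
  have fin: "finite ?X"
    using A(1) by (rule finite_exponents_of_degree)
  have disjoint: "?over u \<inter> ?over v = {}" if "u \<in> A" "v \<in> A" "u \<noteq> v" for u v
  proof -
    have "Poly_Mapping.lookup m u + Poly_Mapping.lookup m v \<le> d" if "m \<in> ?X" for m
    proof -
      have "sum (Poly_Mapping.lookup m) {u, v} \<le> sum (Poly_Mapping.lookup m) A"
        using A \<open>u \<in> A\<close> \<open>v \<in> A\<close> by (intro sum_mono2) auto
      then show ?thesis
        using \<open>u \<noteq> v\<close> \<open>m \<in> ?X\<close> by (simp add: exponents_of_degree_def)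
    qed
    then show ?thesis
      using d by fastforce
  qed
  have "card (\<Union>u \<in> A. ?over u) = (\<Sum>u \<in> A. card (?over u))"
    using A(1) fin disjoint by (intro card_UN_disjoint) auto
  moreover have "card {m \<in> ?X. \<forall>u \<in> A. Poly_Mapping.lookup m u \<le> n} + card (\<Union>u \<in> A. ?over u) = card ?X"
  proof -
    have "?X = {m \<in> ?X. \<forall>u \<in> A. Poly_Mapping.lookup m u \<le> n} \<union> (\<Union>u \<in> A. ?over u)"
      by (auto simp: not_less)
    moreover have "{m \<in> ?X. \<forall>u \<in> A. Poly_Mapping.lookup m u \<le> n} \<inter> (\<Union>u \<in> A. ?over u) = {}"
      by fastforce
    moreover have "finite (\<Union>u \<in> A. ?over u)"
      using A(1) fin by simp
    ultimately show ?thesis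
      using fin card_Un_disjoint[of "{m \<in> ?X. \<forall>u \<in> A. Poly_Mapping.lookup m u \<le> n}" "\<Union>u \<in> A. ?over u"]
      by simp
  qed
  ultimately have "int (card {m \<in> ?X. \<forall>u \<in> A. Poly_Mapping.lookup m u \<le> n}) =
      int (card ?X) - (\<Sum>u \<in> A. int (card (?over u)))"
    by (simp flip: of_nat_sum)
  also have "\<dots> = int (card ?X)
      - (\<Sum>u \<in> A. binom (int d - int n - 1 + int (card A) - 1) (int (card A) - 1))"
    by (simp add: card_exponents_exceeding[OF A(1)])
  finally show ?thesis
    using int_card_exponents_of_degree[OF A] by simp
qed

text \<open>
  A vector on \<open>U \<union> W\<close> is the sum of its restrictions to \<open>W\<close> and \<open>U\<close>; the sum is organised by the degree
  \<open>s\<close> of the first one.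
\<close>

lemma card_exponents_on_disjoint_union:
  assumes U: "finite U" and W: "finite W" and disj: "U \<inter> W = {}"
  shows "card {m \<in> exponents_of_degree (U \<union> W) D. sum (Poly_Mapping.lookup m) W \<le> n \<and>
                 (\<forall>u \<in> U. Q (Poly_Mapping.lookup m u))} =
           (\<Sum>s \<in> {s. s \<le> n \<and> s \<le> D}. card (exponents_of_degree W s) *
              card {m \<in> exponents_of_degree U (D - s). \<forall>u \<in> U. Q (Poly_Mapping.lookup m u)})"
    (is "card ?X = (\<Sum>s \<in> ?S. card (?Y s) * card (?Z s))")
proof -
  define restr where "restr B m = (\<Sum>v \<in> B. Poly_Mapping.single v (Poly_Mapping.lookup m v))"
    for B and m :: "'a \<Rightarrow>\<^sub>0 nat"
  have lookup_restr: "Poly_Mapping.lookup (restr B m) v = (if v \<in> B then Poly_Mapping.lookup m v else 0)"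
    if "finite B" for B m v
    using that by (simp add: restr_def lookup_sum lookup_single when_def)
  have outside: "Poly_Mapping.lookup m v = 0" if "m \<in> exponents_of_degree B k" "v \<notin> B"
    for m B k v
    using that by (auto simp: exponents_of_degree_def in_keys_iff)
  have "bij_betw (\<lambda>(s, e, f). e + f) (SIGMA s:?S. ?Y s \<times> ?Z s) ?X"
  proof (rule bij_betw_byWitness[where
        f' = "\<lambda>m. (sum (Poly_Mapping.lookup m) W, restr W m, restr U m)"])
    have lookup_U: "Poly_Mapping.lookup e u = 0" if "e \<in> ?Y s" "u \<in> U" for e s u
      using that disj by (intro outside[of e W s]) auto
    have lookup_W: "Poly_Mapping.lookup f w = 0" if "f \<in> ?Z s" "w \<in> W" for f s w
      using that disj by (intro outside[of f U "D - s"]) auto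
    have sums: "sum (Poly_Mapping.lookup (e + f)) W = s" "sum (Poly_Mapping.lookup (e + f)) U = D - s"
      if "e \<in> ?Y s" "f \<in> ?Z s" for e f s
      using that lookup_U[OF that(1)] lookup_W[OF that(2)]
      by (simp_all add: exponents_of_degree_def lookup_add)
    have restrs: "restr W (e + f) = e" "restr U (e + f) = f" if "e \<in> ?Y s" "f \<in> ?Z s" for e f s
    proof -
      show "restr W (e + f) = e"
        using that lookup_W[OF that(2)] outside[of e W s]
        by (intro poly_mapping_eqI) (simp add: lookup_restr[OF W] lookup_add)
      show "restr U (e + f) = f"
        using that lookup_U[OF that(1)] outside[of f U "D - s"]
        by (intro poly_mapping_eqI) (simp add: lookup_restr[OF U] lookup_add)
    qed
    show "\<forall>t \<in> (SIGMA s:?S. ?Y s \<times> ?Z s).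
        (\<lambda>m. (sum (Poly_Mapping.lookup m) W, restr W m, restr U m)) ((\<lambda>(s, e, f). e + f) t) = t"
      using sums restrs by auto
    show "\<forall>m \<in> ?X. (\<lambda>(s, e, f). e + f) (sum (Poly_Mapping.lookup m) W, restr W m, restr U m) = m"
    proof
      fix m assume m: "m \<in> ?X"
      have "Poly_Mapping.lookup m v = 0" if "v \<notin> U \<union> W" for v
        using m that by (intro outside[of m "U \<union> W" D]) auto
      then have "restr W m + restr U m = m"
        using disj by (intro poly_mapping_eqI) (auto simp: lookup_restr U W lookup_add)
      then show "(\<lambda>(s, e, f). e + f) (sum (Poly_Mapping.lookup m) W, restr W m, restr U m) = m"
        by simp
    qed
    have "e + f \<in> ?X" if "s \<in> ?S" "e \<in> ?Y s" "f \<in> ?Z s" for s e f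
    proof -
      have "sum (Poly_Mapping.lookup (e + f)) (U \<union> W) = D"
        using sums[OF that(2,3)] that(1) U W disj by (simp add: sum.union_disjoint)
      moreover have "Poly_Mapping.keys (e + f) \<subseteq> U \<union> W"
        using that by (auto simp: keys_add_nat exponents_of_degree_def)
      moreover have "\<forall>u \<in> U. Q (Poly_Mapping.lookup (e + f) u)"
        using that lookup_U[OF that(2)] by (simp add: lookup_add)
      ultimately show ?thesis
        using sums[OF that(2,3)] that(1) by (simp add: exponents_of_degree_def)
    qed
    then show "(\<lambda>(s, e, f). e + f) ` (SIGMA s:?S. ?Y s \<times> ?Z s) \<subseteq> ?X"
      by auto
    have "(sum (Poly_Mapping.lookup m) W, restr W m, restr U m) \<in> (SIGMA s:?S. ?Y s \<times> ?Z s)"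
      if m: "m \<in> ?X" for m
    proof -
      have total: "sum (Poly_Mapping.lookup m) U + sum (Poly_Mapping.lookup m) W = D"
        using m U W disj by (simp add: exponents_of_degree_def sum.union_disjoint)
      have keys: "Poly_Mapping.keys (restr B m) \<subseteq> B" if "finite B" for B
        using lookup_restr[OF that] by (auto simp: in_keys_iff split: if_splits)
      have "restr W m \<in> ?Y (sum (Poly_Mapping.lookup m) W)"
        using keys[OF W] by (simp add: exponents_of_degree_def lookup_restr[OF W])
      moreover have "restr U m \<in> ?Z (sum (Poly_Mapping.lookup m) W)"
        using keys[OF U] total m by (auto simp: exponents_of_degree_def lookup_restr[OF U])
      ultimately show ?thesis
        using total m by simp
    qed
    then show "(\<lambda>m. (sum (Poly_Mapping.lookup m) W, restr W m, restr U m)) ` ?X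
        \<subseteq> (SIGMA s:?S. ?Y s \<times> ?Z s)"
      by blast
  qed
  then have "card ?X = card (SIGMA s:?S. ?Y s \<times> ?Z s)"
    by (rule bij_betw_same_card[symmetric])
  also have "\<dots> = (\<Sum>s \<in> ?S. card (?Y s \<times> ?Z s))"
    using U W by (intro card_SigmaI) (auto intro: finite_exponents_of_degree finite_subset)
  finally show ?thesis
    by (simp add: card_cartesian_product)
qed

section \<open>Edge ideals of prime ideal graphs\<close>

lemma mu_multipartite_power:
  assumes V: "finite V"
  shows "mu V ((monomial_span V (multipartite_edges part V) :: (('v \<Rightarrow>\<^sub>0 nat) \<Rightarrow>\<^sub>0 'k::field) set)
              [^]\<^bsub>ideals_set (mpoly_ring V)\<^esub> n) =
           card {m \<in> exponents_of_degree V (2 * n). \<forall>v \<in> V. part_degree part V m (part v) \<le> n}"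
proof -
  let ?E = "multipartite_edges part V"
  have keys_E: "Poly_Mapping.keys m \<subseteq> V" if "m \<in> ?E" for m
    using that by (auto simp: multipartite_edges_def keys_add_nat)
  have degree: "m \<in> exponents_of_degree V (2 * n)" if "m \<in> iterated_sumset ?E n" for m
    using that by (simp add: iterated_sumset_multipartite_edges[OF V])
  have "mu V (monomial_span V (iterated_sumset ?E n) :: (('v \<Rightarrow>\<^sub>0 nat) \<Rightarrow>\<^sub>0 'k) set) =
          card (iterated_sumset ?E n)"
  proof (rule mu_monomial_span)
    show "Poly_Mapping.keys m \<subseteq> V" if "m \<in> iterated_sumset ?E n" for m
      using degree[OF that] by (simp add: exponents_of_degree_def)
    \<comment> \<open>All vectors have degree \<open>2 * n\<close>, so a quotient of two of them has degree 0.\<close>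
    show "e = 0" if "m \<in> iterated_sumset ?E n" "d \<in> iterated_sumset ?E n" "m = d + e" for m d e
    proof -
      have "e \<in> exponents_of_degree V 0"
        using degree[OF that(1)] degree[OF that(2)] unfolding that(3)
        by (simp add: exponents_of_degree_def keys_add_nat lookup_add sum.distrib)
      then show ?thesis
        using exponents_of_degree_0[OF V] by blast
    qed
  qed
  moreover have "monomial_span V ?E [^]\<^bsub>ideals_set (mpoly_ring V)\<^esub> n =
      (monomial_span V (iterated_sumset ?E n) :: (('v \<Rightarrow>\<^sub>0 nat) \<Rightarrow>\<^sub>0 'k) set)"
    by (rule monomial_span_power) (rule keys_E)
  ultimately show ?thesis
    by (simp add: iterated_sumset_multipartite_edges[OF V])
qed

text \<open>
  The partition into the singletons of \<open>U\<close> and the complement of \<open>U\<close>. The option type supplies a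
  label for the complement that no element of \<open>U\<close> can have.
\<close>

definition split_part :: "'v set \<Rightarrow> 'v \<Rightarrow> 'v option" where
  "split_part U v = (if v \<in> U then Some v else None)"

lemma card_split_multipartite_exponents:
  assumes U: "finite U" "U \<noteq> {}" and W: "finite W" "W \<noteq> {}" and disj: "U \<inter> W = {}"
  defines "a \<equiv> int (card U)" and "b \<equiv> int (card W)"
  shows "int (card {m \<in> exponents_of_degree (U \<union> W) (2 * n).
            \<forall>v \<in> U \<union> W. part_degree (split_part U) (U \<union> W) m (split_part U v) \<le> n}) =
         (\<Sum>s = 0..n. binom (int s + b - 1) (b - 1) *
            (binom (2 * int n - int s + a - 1) (a - 1) - a * binom (int n - int s + a - 2) (a - 1)))"
proof -
  let ?deg = "part_degree (split_part U) (U \<union> W)"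
  have part_U: "?deg m (split_part U u) = Poly_Mapping.lookup m u" if "u \<in> U" for m u
  proof -
    have "{v \<in> U \<union> W. split_part U v = split_part U u} = {u}"
      using that by (auto simp: split_part_def)
    then show ?thesis
      by (simp add: part_degree_def)
  qed
  have part_W: "?deg m (split_part U w) = sum (Poly_Mapping.lookup m) W" if "w \<in> W" for m w
  proof -
    have "{v \<in> U \<union> W. split_part U v = split_part U w} = W"
      using that disj by (auto simp: split_part_def)
    then show ?thesis
      by (simp add: part_degree_def)
  qed
  have "(\<forall>v \<in> U \<union> W. ?deg m (split_part U v) \<le> n) \<longleftrightarrow>
      sum (Poly_Mapping.lookup m) W \<le> n \<and> (\<forall>u \<in> U. Poly_Mapping.lookup m u \<le> n)" for m
    using W(2) part_U part_W by (metis UnCI UnE all_not_in_conv)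
  then have "card {m \<in> exponents_of_degree (U \<union> W) (2 * n). \<forall>v \<in> U \<union> W. ?deg m (split_part U v) \<le> n} =
      (\<Sum>s \<in> {s. s \<le> n \<and> s \<le> 2 * n}. card (exponents_of_degree W s) *
         card {m \<in> exponents_of_degree U (2 * n - s). \<forall>u \<in> U. Poly_Mapping.lookup m u \<le> n})"
    using card_exponents_on_disjoint_union[OF U(1) W(1) disj, of "2 * n" n "\<lambda>k. k \<le> n"] by simp
  also have "{s. s \<le> n \<and> s \<le> 2 * n} = {0..n}"
    by auto
  finally have "int (card {m \<in> exponents_of_degree (U \<union> W) (2 * n). \<forall>v \<in> U \<union> W. ?deg m (split_part U v) \<le> n}) =
      (\<Sum>s = 0..n. int (card (exponents_of_degree W s)) *
         int (card {m \<in> exponents_of_degree U (2 * n - s). \<forall>u \<in> U. Poly_Mapping.lookup m u \<le> n}))"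
    by simp
  also have "\<dots> = (\<Sum>s = 0..n. binom (int s + b - 1) (b - 1) *
            (binom (2 * int n - int s + a - 1) (a - 1) - a * binom (int n - int s + a - 2) (a - 1)))"
  proof (rule sum.cong[OF refl])
    fix s assume "s \<in> {0..n}"
    then have "int (2 * n - s) = 2 * int n - int s"
      by (simp add: of_nat_diff)
    moreover have "2 * int n - int s - int n - 1 + a - 1 = int n - int s + a - 2"
      by simp
    ultimately have "int (card {m \<in> exponents_of_degree U (2 * n - s). \<forall>u \<in> U. Poly_Mapping.lookup m u \<le> n}) =
        binom (2 * int n - int s + a - 1) (a - 1) - a * binom (int n - int s + a - 2) (a - 1)"
      using int_card_exponents_bounded[OF U diff_le_self, of n s, folded a_def] by (simp only:)
    then show "int (card (exponents_of_degree W s)) *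
         int (card {m \<in> exponents_of_degree U (2 * n - s). \<forall>u \<in> U. Poly_Mapping.lookup m u \<le> n}) =
        binom (int s + b - 1) (b - 1) *
            (binom (2 * int n - int s + a - 1) (a - 1) - a * binom (int n - int s + a - 2) (a - 1))"
      using int_card_exponents_of_degree[OF W, of s] by (simp add: b_def)
  qed
  finally show ?thesis .
qed

lemma edge_ideal_multipartite:
  "edge_ideal (V, {{x, y} |x y. x \<in> V \<and> y \<in> V \<and> part x \<noteq> part y}) =
     (monomial_span V (multipartite_edges part V) :: (('v \<Rightarrow>\<^sub>0 nat) \<Rightarrow>\<^sub>0 'k::field) set)"
proof -
  let ?E = "{{x, y} |x y. x \<in> V \<and> y \<in> V \<and> part x \<noteq> part y}"
  have edge: "{x, y} \<in> ?E \<longleftrightarrow> x \<in> V \<and> y \<in> V \<and> part x \<noteq> part y" for x y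
    by (auto simp: doubleton_eq_iff)
  have "{var x * var y |x y. {x, y} \<in> ?E} =
      (monom ` multipartite_edges part V :: (('v \<Rightarrow>\<^sub>0 nat) \<Rightarrow>\<^sub>0 'k) set)"
    unfolding edge multipartite_edges_def var_def monom_mult[symmetric] by blast
  moreover have "Idl\<^bsub>mpoly_ring V\<^esub> (monom ` multipartite_edges part V) =
      (monomial_span V (multipartite_edges part V) :: (('v \<Rightarrow>\<^sub>0 nat) \<Rightarrow>\<^sub>0 'k) set)"
    by (rule Idl_monom_image) (auto simp: multipartite_edges_def keys_add_nat)
  ultimately show ?thesis
    by (simp add: edge_ideal_def)
qed

text \<open>
  Primality gives \<open>xy \<in> P\<close> if and only if \<open>x \<in> P\<close> or \<open>y \<in> P\<close>. So among distinct nonzero elements exactly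
  the pairs outside \<open>P\<close> are non-adjacent.
\<close>

lemma prime_ideal_graph_multipartite:
  assumes "primeideal P R"
  defines "V \<equiv> carrier R - {\<zero>\<^bsub>R\<^esub>}"
  shows "prime_ideal_graph R P =
           (V, {{x, y} |x y. x \<in> V \<and> y \<in> V \<and>
                  split_part (P - {\<zero>\<^bsub>R\<^esub>}) x \<noteq> split_part (P - {\<zero>\<^bsub>R\<^esub>}) y})"
proof -
  interpret primeideal P R by (rule assms)
  have "x \<noteq> y \<and> x \<otimes>\<^bsub>R\<^esub> y \<in> P \<longleftrightarrow>
      split_part (P - {\<zero>\<^bsub>R\<^esub>}) x \<noteq> split_part (P - {\<zero>\<^bsub>R\<^esub>}) y"
    if "x \<in> V" "y \<in> V" for x y
  proof -
    have "x \<otimes>\<^bsub>R\<^esub> y \<in> P \<longleftrightarrow> x \<in> P \<or> y \<in> P"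
      using that I_prime[of x y] I_l_closed[of y x] I_r_closed[of x y] by (auto simp: V_def)
    then show ?thesis
      using that by (auto simp: split_part_def V_def)
  qed
  then have "{{x, y} |x y. x \<in> V \<and> y \<in> V \<and> x \<noteq> y \<and> x \<otimes>\<^bsub>R\<^esub> y \<in> P} =
      {{x, y} |x y. x \<in> V \<and> y \<in> V \<and>
                  split_part (P - {\<zero>\<^bsub>R\<^esub>}) x \<noteq> split_part (P - {\<zero>\<^bsub>R\<^esub>}) y}"
    by blast
  then show ?thesis
    by (simp add: prime_ideal_graph_def V_def)
qed

theorem theorem4p6:
  fixes R :: "('r, 'm) ring_scheme"
    and P :: "'r set"
    and I :: "(('r \<Rightarrow>\<^sub>0 nat) \<Rightarrow>\<^sub>0 'k::field) set"
    and a b :: int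
    and n :: nat
  assumes "cring R" and "finite (carrier R)"
    and "primeideal P R" and "card P \<ge> 2"
    and a: "a = int (card P) - 1"
    and b: "b = int (card P) * (int (card (carrier (R Quot P))) - 1)"
    and I: "I = edge_ideal (prime_ideal_graph R P)"
    and "n \<ge> 1"
  shows "int (mu (carrier R - {\<zero>\<^bsub>R\<^esub>}) (I [^]\<^bsub>ideals_set (mpoly_ring (carrier R - {\<zero>\<^bsub>R\<^esub>}))\<^esub> n)) =
           (\<Sum>s = 0..n. binom (int s + b - 1) (b - 1) *
              (binom (2 * int n - int s + a - 1) (a - 1)
                 - a * binom (int n - int s + a - 2) (a - 1)))
       \<and> int (mu (carrier R - {\<zero>\<^bsub>R\<^esub>}) (I [^]\<^bsub>ideals_set (mpoly_ring (carrier R - {\<zero>\<^bsub>R\<^esub>}))\<^esub> n)) =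
           (\<Sum>s = 0..n.
              binom (int s + int (card P) * (int (card (carrier (R Quot P))) - 1) - 1)
                    (int (card P) * (int (card (carrier (R Quot P))) - 1) - 1) *
              (binom (2 * int n - int s + int (card P) - 2) (int (card P) - 2)
                 - (int (card P) - 1) * binom (int n - int s + int (card P) - 3) (int (card P) - 2)))"
proof -
  interpret primeideal P R by (rule assms)
  define V where "V = carrier R - {\<zero>\<^bsub>R\<^esub>}"
  define U where "U = P - {\<zero>\<^bsub>R\<^esub>}"
  define W where "W = carrier R - P"
  have zero: "\<zero>\<^bsub>R\<^esub> \<in> P"
    by (rule additive_subgroup.zero_closed[OF additive_subgroup_axioms])
  have P: "P \<subseteq> carrier R"
    by (rule a_subset)
  then have finite_P: "finite P"
    using assms(2) by (rule finite_subset)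
  have V: "V = U \<union> W" and disj: "U \<inter> W = {}"
    using zero P by (auto simp: U_def V_def W_def)
  have finite: "finite U" "finite W"
    using finite_P assms(2) by (simp_all add: U_def W_def)
  have card_U: "int (card U) = a"
    using zero finite_P assms(4) by (simp add: U_def a)
  have card_W: "int (card W) = b"
  proof -
    have "card (carrier (R Quot P)) * card P = card (carrier R)"
      using a_lagrange[OF assms(2) additive_subgroup_axioms] by (simp add: FactRing_def order_def)
    then have "int (card (carrier R)) = int (card P) * int (card (carrier (R Quot P)))"
      by (metis of_nat_mult mult.commute)
    moreover have "int (card W) = int (card (carrier R)) - int (card P)"
      using P finite_P assms(2) by (simp add: W_def card_Diff_subset card_mono of_nat_diff)
    ultimately show ?thesis
      by (simp add: b algebra_simps)
  qed
  have "U \<noteq> {}"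
    using card_U assms(4) a by auto
  moreover have "W \<noteq> {}"
    using P I_notcarr by (auto simp: W_def)
  ultimately have formula:
    "int (card {m \<in> exponents_of_degree V (2 * n).
            \<forall>v \<in> V. part_degree (split_part U) V m (split_part U v) \<le> n}) =
         (\<Sum>s = 0..n. binom (int s + b - 1) (b - 1) *
            (binom (2 * int n - int s + a - 1) (a - 1) - a * binom (int n - int s + a - 2) (a - 1)))"
    using card_split_multipartite_exponents[of U W n] finite disj by (simp add: V card_U card_W)
  have "I = monomial_span V (multipartite_edges (split_part U) V)"
    unfolding I prime_ideal_graph_multipartite[OF assms(3)] U_def V_def
    by (rule edge_ideal_multipartite)
  then have "mu V (I [^]\<^bsub>ideals_set (mpoly_ring V)\<^esub> n) =
      card {m \<in> exponents_of_degree V (2 * n).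
            \<forall>v \<in> V. part_degree (split_part U) V m (split_part U v) \<le> n}"
    using mu_multipartite_power[of V "split_part U" n] finite by (simp add: V)
  then have main: "int (mu V (I [^]\<^bsub>ideals_set (mpoly_ring V)\<^esub> n)) =
         (\<Sum>s = 0..n. binom (int s + b - 1) (b - 1) *
            (binom (2 * int n - int s + a - 1) (a - 1) - a * binom (int n - int s + a - 2) (a - 1)))"
    using formula by simp
  moreover have "2 * int n - int s + a - 1 = 2 * int n - int s + int (card P) - 2"
    "a - 1 = int (card P) - 2" "int n - int s + a - 2 = int n - int s + int (card P) - 3" for s
    by (simp_all add: a)
  ultimately show ?thesis
    unfolding V_def[symmetric] by (simp only: b a[symmetric])
qed

end
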